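(* Let $G$ be a $p$-group acting on a set $X$ with $|X|\geq 2$. Assume further that there is a generating subset $S\subseteq G$ such that for all $s\in S$ there exists an $x\in X$ such that $s\cdot x=x$. Then $X$ has at least two $G$-orbits.
   Context: Here $p$ is a prime number. For $g\in G$ and $x\in X$, $g\cdot x$ denotes the image of $x$ under the action of $g$. *)

theory Defs
  imports "HOL-Algebra.Group_Action" "HOL-Algebra.Generated_Groups"
    "HOL-Computational_Algebra.Primes"
begin

(* A p-group here is a finite group of p-power order: since order G = 0 for an infinite carrier,
   the equation order G = p ^ n forces finiteness. The trivial group (n = 0) is included. *)
definition p_group :: "nat \<Rightarrow> ('a, 'b) monoid_scheme \<Rightarrow> bool" where
  "p_group p G \<longleftrightarrow> prime p \<and> group G \<and> (\<exists>n. order G = p ^ n)"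

end

theory Submission
  imports Defs
begin

text \<open>
  If there were a single orbit, the stabilizer of a point would be a proper subgroup and would lie
  in a maximal proper subgroup, which is normal because normalizers grow in a \<open>p\<close>-group. Every
  element with a fixed point is conjugate into that stabilizer, so all of \<open>S\<close> would lie in this
  normal subgroup and could not generate \<open>G\<close>.
\<close>

text \<open>Invariance makes \<open>A\<close> a disjoint union of orbits. By the orbit-stabilizer
  theorem each orbit size divides \<open>p ^ n\<close>, hence is a power of \<open>p\<close>, and it
  is not 1 because every point of \<open>A\<close> is moved.\<close>

lemma (in group_action) prime_dvd_card_if_no_fixed_point:
  assumes p: "prime p" and ord: "order G = p ^ n"
    and A: "A \<subseteq> E" "finite A"
    and inv: "\<And>g x. g \<in> carrier G \<Longrightarrow> x \<in> A \<Longrightarrow> \<phi> g x \<in> A"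
    and moved: "\<And>x. x \<in> A \<Longrightarrow> \<exists>g\<in>carrier G. \<phi> g x \<noteq> x"
  shows "p dvd card A"
proof -
  have A_eq: "\<Union> (orbit G \<phi> ` A) = A"
    using inv orbit_refl A(1) by (fastforce simp: orbit_def)
  have "p dvd card (\<Union> (orbit G \<phi> ` A))"
  proof (rule dvd_partition)
    show "\<forall>c\<in>orbit G \<phi> ` A. p dvd card c"
    proof safe
      fix x assume x: "x \<in> A"
      then have xE: "x \<in> E" using A(1) by auto
      have "card (orbit G \<phi> x) dvd p ^ n"
        using orbit_stabilizer_theorem[OF xE] ord by (metis dvd_triv_left)
      then obtain i where i: "card (orbit G \<phi> x) = p ^ i"
        using divides_primepow_nat[OF p] by auto
      obtain g where g: "g \<in> carrier G" "\<phi> g x \<noteq> x" using moved[OF x] by blast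
      have "x \<in> orbit G \<phi> x" "\<phi> g x \<in> orbit G \<phi> x"
        using orbit_refl[OF xE] g by (auto simp: orbit_def)
      \<comment> \<open>Two distinct points in the orbit exclude the exponent 0.\<close>
      then have "card (orbit G \<phi> x) \<noteq> 1"
        using g(2) by (metis card_1_singletonE singletonD)
      then show "p dvd card (orbit G \<phi> x)"
        using i by (cases i) auto
    qed
    show "\<forall>c\<in>orbit G \<phi> ` A. \<forall>d\<in>orbit G \<phi> ` A. c \<noteq> d \<longrightarrow> c \<inter> d = {}"
      using disjoint_union A(1) unfolding orbits_def by blast
    show "finite (\<Union> (orbit G \<phi> ` A))" using A(2) A_eq by simp
  qed
  then show ?thesis using A_eq by simp
qed

lemma finite_carrier_if_order_primepow:
  fixes p :: nat
  assumes "prime p" "order G = p ^ n"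
  shows "finite (carrier G)"
proof (rule card_ge_0_finite)
  show "0 < card (carrier G)"
    using assms prime_gt_0_nat by (simp add: order_def)
qed

lemma (in group) subgroup_conjugation_by_member:
  assumes "subgroup M G" "g \<in> M"
  shows "g <# M #> inv g = M"
proof -
  have "g \<in> carrier G" "inv g \<in> M"
    using assms by (auto simp: subgroup.mem_carrier subgroup.m_inv_closed)
  then show ?thesis
    using assms by (simp add: coset_join2 coset_join3)
qed

text \<open>Count the conjugates of \<open>M\<close>. If \<open>M\<close> were its own normalizer,
  their number would be the index of \<open>M\<close>, a multiple of \<open>p\<close>. Yet
  \<open>M\<close> acts by conjugation on the conjugates other than \<open>M\<close> without fixed
  points, so that number minus one is also a multiple of \<open>p\<close>.\<close>

lemma (in group) normalizer_of_proper_subgroup: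
  assumes p: "prime p" and ord: "order G = p ^ n"
    and M: "subgroup M G" "M \<noteq> carrier G"
  shows "\<exists>g\<in>carrier G - M. g <# M #> inv g = M"
proof (rule ccontr)
  assume neg: "\<not> ?thesis"
  define E where "E = {H. subgroup H G}"
  \<comment> \<open>The lambda is restricted to \<open>E\<close> because a
    \<open>group_action\<close> takes values in the extensional bijections of
    \<open>E\<close>.\<close>
  define c where "c = (\<lambda>g. \<lambda>H \<in> E. g <# H #> inv g)"
  interpret act: group_action G E c
    unfolding E_def c_def by (rule action_by_conjugation_on_subgroups_set)
  have fin: "finite (carrier G)"
    using p ord by (rule finite_carrier_if_order_primepow)
  have ME: "M \<in> E" using M(1) by (simp add: E_def)
  have Msub: "M \<subseteq> carrier G" using M(1) by (rule subgroup.subset)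
  have cM: "c g M = g <# M #> inv g" for g using ME by (simp add: c_def)
  have "c g M = M" if "g \<in> M" for g
    unfolding cM using M(1) that by (rule subgroup_conjugation_by_member)
  then have stab: "stabilizer G c M = M"
    using neg Msub by (auto simp: stabilizer_def cM)
  \<comment> \<open>The only conjugate of \<open>M\<close> fixed by all of \<open>M\<close> is
    \<open>M\<close> itself: if \<open>M\<close> fixes \<open>c g M\<close>, then each
    \<open>inv g \<otimes> m \<otimes> g\<close> fixes \<open>M\<close> and so lies in
    \<open>M\<close> by \<open>stab\<close>.\<close>
  have self: "M = c g M" if g: "g \<in> carrier G" and fixed: "\<And>m. m \<in> M \<Longrightarrow> c m (c g M) = c g M" for g
  proof -
    let ?f = "\<lambda>m. inv g \<otimes> m \<otimes> g"
    have "?f m \<in> M" if m: "m \<in> M" for m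
    proof -
      have mG: "m \<in> carrier G" using m Msub by auto
      have gM: "c g M \<in> E" using act.element_image[OF g ME refl] .
      have "c (inv g \<otimes> m \<otimes> g) M = c (inv g) (c m (c g M))"
        using g mG ME gM act.composition_rule by simp
      also have "\<dots> = M"
        using fixed[OF m] act.orbit_sym_aux[OF g ME refl] by simp
      finally have "?f m \<in> stabilizer G c M" using g mG by (simp add: stabilizer_def)
      then show ?thesis using stab by simp
    qed
    moreover have "inj_on ?f M"
      using g Msub by (intro inj_onI) (auto simp: subset_iff)
    ultimately have img: "?f ` M = M"
      by (intro endo_inj_surj) (use fin Msub finite_subset in auto)
    have conj: "g \<otimes> ?f m \<otimes> inv g = m" if "m \<in> M" for m
      using that g Msub conjugation_is_surj by blast
    have "c g M = (\<lambda>m. g \<otimes> m \<otimes> inv g) ` M"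
      unfolding cM by (auto simp: l_coset_def r_coset_def)
    also have "\<dots> = (\<lambda>m. g \<otimes> ?f m \<otimes> inv g) ` M"
      by (subst img[symmetric]) (simp add: image_image)
    also have "\<dots> = M" using conj by simp
    finally show ?thesis by simp
  qed
  \<comment> \<open>The same conjugation action, restricted to the acting group
    \<open>M\<close>.\<close>
  interpret M: group_action "G\<lparr>carrier := M\<rparr>" E c
    by (rule act.induced_action[OF M(1)])
  have orb: "card (orbit G c M) * card M = p ^ n"
    using act.orbit_stabilizer_theorem[OF ME] stab ord by simp
  obtain i where i: "card (orbit G c M) = p ^ i"
    using divides_primepow_nat[OF p] orb by (metis dvd_triv_left)
  obtain j where j: "card M = p ^ j"
    using divides_primepow_nat[OF p] orb by (metis dvd_triv_right)
  \<comment> \<open>Properness of \<open>M\<close> enters here: the index \<open>p ^ i\<close>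
    cannot be 1.\<close>
  have "card M \<noteq> p ^ n"
    using card_subset_eq[OF fin Msub] M(2) ord by (auto simp: order_def)
  then have "i \<noteq> 0" using i orb by (cases i) auto
  then have dvd: "p dvd card (orbit G c M)" using i by simp
  have Mo: "M \<in> orbit G c M" by (rule act.orbit_refl[OF ME])
  have fino: "finite (orbit G c M)" unfolding orbit_def using fin by simp
  have "p dvd card (orbit G c M - {M})"
  proof (rule M.prime_dvd_card_if_no_fixed_point[OF p, of j])
    show "order (G\<lparr>carrier := M\<rparr>) = p ^ j" using j by (simp add: order_def)
    show "orbit G c M - {M} \<subseteq> E"
      using act.element_image ME unfolding orbit_def by blast
    show "finite (orbit G c M - {M})" using fino by simp
  next
    fix m K assume m: "m \<in> carrier (G\<lparr>carrier := M\<rparr>)" and K: "K \<in> orbit G c M - {M}"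
    then have mM: "m \<in> M" "m \<in> carrier G" using Msub by auto
    obtain g where g: "g \<in> carrier G" "K = c g M" using K by (auto simp: orbit_def)
    have KE: "K \<in> E" using g ME act.element_image by blast
    have "c m K = c (m \<otimes> g) M" using g mM ME by (simp add: act.composition_rule)
    then have "c m K \<in> orbit G c M" using g mM by (auto simp: orbit_def)
    \<comment> \<open>Since \<open>m\<close> fixes \<open>M\<close> and acts injectively, it sends
      no other conjugate to \<open>M\<close>.\<close>
    moreover have "c m K \<noteq> M"
    proof
      assume "c m K = M"
      moreover have "c m M = M" using stab mM(1) by (auto simp: stabilizer_def)
      ultimately have "K = M"
        using act.inj_prop[OF mM(2)] KE ME by (metis inj_onD)
      with K show False by simp
    qed
    ultimately show "c m K \<in> orbit G c M - {M}" by simp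
  next
    fix K assume K: "K \<in> orbit G c M - {M}"
    then obtain g where "g \<in> carrier G" "K = c g M" by (auto simp: orbit_def)
    then show "\<exists>m\<in>carrier (G\<lparr>carrier := M\<rparr>). c m K \<noteq> K"
      using self[of g] K by auto
  qed
  moreover have "card (orbit G c M) = Suc (card (orbit G c M - {M}))"
    using card_Suc_Diff1[OF fino Mo] by simp
  \<comment> \<open>Here \<open>p\<close> divides two consecutive numbers.\<close>
  ultimately have "p dvd 1" using dvd by (metis Suc_eq_plus1 dvd_add_right_iff)
  then show False using p by (simp add: prime_nat_iff)
qed

text \<open>Finiteness provides a maximal proper subgroup \<open>M\<close> above \<open>H\<close>.
  Its normalizer is strictly larger, so by maximality it is all of \<open>G\<close>, which makes
  \<open>M\<close> normal.\<close>

lemma (in group) proper_subgroup_le_proper_normal: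
  assumes p: "prime p" and ord: "order G = p ^ n"
    and H: "subgroup H G" "H \<noteq> carrier G"
  shows "\<exists>N. N \<lhd> G \<and> H \<subseteq> N \<and> N \<noteq> carrier G"
proof -
  define P where "P = {K. subgroup K G \<and> K \<noteq> carrier G}"
  have fin: "finite (carrier G)"
    using p ord by (rule finite_carrier_if_order_primepow)
  have finP: "finite P"
    by (rule finite_subset[of _ "Pow (carrier G)"])
      (use fin in \<open>auto simp: P_def dest: subgroup.subset\<close>)
  then obtain M where M: "M \<in> P" "H \<subseteq> M" and max: "\<And>K. K \<in> P \<Longrightarrow> M \<subseteq> K \<Longrightarrow> M = K"
  proof -
    have "H \<in> P" using H by (simp add: P_def)
    from finite_has_maximal2[OF finP this] show ?thesis using that by metis
  qed
  have Ms: "subgroup M G" "M \<noteq> carrier G" using M(1) by (auto simp: P_def)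
  have Msub: "M \<subseteq> carrier G" using Ms(1) by (rule subgroup.subset)
  have norm: "normalizer G M = {g \<in> carrier G. g <# M #> inv g = M}"
    using Msub by (auto simp: normalizer_def stabilizer_def)
  have sub: "subgroup (normalizer G M) G" using Msub by (rule normalizer_imp_subgroup)
  have "g <# M #> inv g = M" if "g \<in> M" for g
    using Ms(1) that by (rule subgroup_conjugation_by_member)
  then have "M \<subseteq> normalizer G M" using Msub unfolding norm by blast
  moreover have "M \<noteq> normalizer G M"
    using normalizer_of_proper_subgroup[OF p ord Ms] unfolding norm by blast
  ultimately have full: "normalizer G M = carrier G"
    using max[of "normalizer G M"] sub unfolding P_def by blast
  have "g \<otimes> h \<otimes> inv g \<in> M" if g: "g \<in> carrier G" and h: "h \<in> M" for g h
  proof -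
    have "g <# M #> inv g = M" using full g unfolding norm by blast
    then show ?thesis using h by (auto simp: l_coset_def r_coset_def)
  qed
  then have "M \<lhd> G" using Ms(1) by (simp add: normal_inv_iff)
  then show ?thesis using M(2) Ms(2) by blast
qed

theorem theorem3p1:
  fixes p :: nat
    and G :: "('g, 'm) monoid_scheme"
    and X :: "'x set"
    and act :: "'g \<Rightarrow> 'x \<Rightarrow> 'x"
    and S :: "'g set"
  assumes "prime p"
    and "p_group p G"
    and "group_action G X act"
    and "\<exists>x\<in>X. \<exists>y\<in>X. x \<noteq> y"
    and "S \<subseteq> carrier G"
    and "generate G S = carrier G"
    and "\<forall>s\<in>S. \<exists>x\<in>X. act s x = x"
  shows "\<exists>A\<in>orbits G X act. \<exists>B\<in>orbits G X act. A \<noteq> B"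
proof (rule ccontr)
  assume one: "\<not> ?thesis"
  interpret group_action G X act by fact
  interpret group G using assms(2) by (simp add: p_group_def)
  obtain n where ord: "order G = p ^ n" using assms(2) by (auto simp: p_group_def)
  obtain x y where xy: "x \<in> X" "y \<in> X" "x \<noteq> y" using assms(4) by blast
  \<comment> \<open>With a single orbit the action is transitive, so every point can be reached from
    the base point \<open>x\<close>.\<close>
  have trans: "\<exists>g\<in>carrier G. act g x = z" if z: "z \<in> X" for z
  proof -
    have "orbit G act x = orbit G act z" using one xy(1) z unfolding orbits_def by blast
    then have "z \<in> orbit G act x" using orbit_refl[OF z] by simp
    then show ?thesis by (auto simp: orbit_def)
  qed
  obtain k where k: "k \<in> carrier G" "act k x = y" using trans[OF xy(2)] by blast
  then have "k \<notin> stabilizer G act x" using xy(3) by (simp add: stabilizer_def)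
  then have "stabilizer G act x \<noteq> carrier G" using k(1) by metis
  then obtain N where N: "N \<lhd> G" "stabilizer G act x \<subseteq> N" "N \<noteq> carrier G"
    using proper_subgroup_le_proper_normal[OF assms(1) ord stabilizer_subgroup[OF xy(1)]] by blast
  have "s \<in> N" if s: "s \<in> S" for s
  proof -
    have sG: "s \<in> carrier G" using s assms(5) by auto
    obtain z where z: "z \<in> X" "act s z = z" using assms(7) s by blast
    obtain g where g: "g \<in> carrier G" "act g x = z" using trans[OF z(1)] by blast
    \<comment> \<open>Conjugation by \<open>g\<close> carries the fixed point \<open>z\<close> of
      \<open>s\<close> back to \<open>x\<close>; normality of \<open>N\<close> afterwards undoes the
      conjugation.\<close>
    have "act (inv\<^bsub>G\<^esub> g \<otimes>\<^bsub>G\<^esub> s \<otimes>\<^bsub>G\<^esub> g) x = act (inv\<^bsub>G\<^esub> g) (act s (act g x))"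
      using g sG xy(1) z(1) by (simp add: composition_rule m_assoc)
    also have "\<dots> = x" using g z orbit_sym_aux[OF g(1) xy(1) g(2)] by simp
    finally have "inv\<^bsub>G\<^esub> g \<otimes>\<^bsub>G\<^esub> s \<otimes>\<^bsub>G\<^esub> g \<in> N"
      using N(2) g sG by (auto simp: stabilizer_def)
    then have "g \<otimes>\<^bsub>G\<^esub> (inv\<^bsub>G\<^esub> g \<otimes>\<^bsub>G\<^esub> s \<otimes>\<^bsub>G\<^esub> g) \<otimes>\<^bsub>G\<^esub> inv\<^bsub>G\<^esub> g \<in> N"
      using N(1) g(1) by (simp add: normal_inv_iff)
    then show ?thesis using conjugation_is_surj[OF g(1) sG] by simp
  qed
  then have "generate G S \<subseteq> N"
    using generate_subgroup_incl[of S N] N(1) by (auto simp: normal_imp_subgroup)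
  then show False
    using assms(6) N(1,3) subgroup.subset[OF normal_imp_subgroup[OF N(1)]] by auto
qed

end
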